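(* For all $n\ge1$, $a_{n,2,00}=1+\binom{n}{2}$.
   Context: For a finite integer sequence $(a_1,\dots,a_i)$, $\mathrm{asc}(a_1,\dots,a_i)=|\{j:1\le j<i,\ a_j<a_{j+1}\}|$. For an integer $p\ge1$, a $p$-ascent sequence of length $n\ge1$ is a sequence $(a_1,\dots,a_n)$ of nonnegative integers with $a_1=0$ and $a_i\le p+\mathrm{asc}(a_1,\dots,a_{i-1})$ for all $2\le i\le n$. $a_{n,p,00}$ is the number of $p$-ascent sequences of length $n$ avoiding the pattern $00$, i.e. having all letters distinct. *)

theory Defs
  imports "HOL-Library.Sublist"
begin

(* Positions are counted from 0, so the index j here is j + 1 in the usual 1-based notation. *)
definition asc :: "'a::linorder list \<Rightarrow> nat" where
  "asc xs = card {j. Suc j < length xs \<and> xs ! j < xs ! Suc j}"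

(* With 0-based positions, the prefix preceding the letter xs ! i is take i xs. *)
definition p_ascent_sequence :: "nat \<Rightarrow> nat list \<Rightarrow> bool" where
  "p_ascent_sequence p xs \<longleftrightarrow>
     xs \<noteq> [] \<and> xs ! 0 = 0 \<and>
     (\<forall>i. 1 \<le> i \<and> i < length xs \<longrightarrow> xs ! i \<le> p + asc (take i xs))"

(* On a linear order, preserving and reflecting < also preserves and reflects equality
   of letters. *)
definition order_isomorphic :: "'a::linorder list \<Rightarrow> 'b::linorder list \<Rightarrow> bool" where
  "order_isomorphic xs ys \<longleftrightarrow>
     length xs = length ys \<and>
     (\<forall>i < length xs. \<forall>j < length xs. xs ! i < xs ! j \<longleftrightarrow> ys ! i < ys ! j)"

(* Classical patterns: the letters of an occurrence need not be adjacent. *)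
definition avoids :: "'a::linorder list \<Rightarrow> nat list \<Rightarrow> bool" where
  "avoids xs pat \<longleftrightarrow> \<not> (\<exists>ys. subseq ys xs \<and> order_isomorphic ys pat)"

lemma avoids_00_iff_distinct: "avoids xs [0, 0] \<longleftrightarrow> distinct xs"
proof -
  have iso: "order_isomorphic ys [0, 0 :: nat] \<longleftrightarrow> (\<exists>a. ys = [a, a])" for ys :: "'a list"
  proof
    assume iso: "order_isomorphic ys [0, 0 :: nat]"
    then obtain a b where ys: "ys = [a, b]"
      by (auto simp: order_isomorphic_def length_Suc_conv numeral_2_eq_2)
    with iso have "\<not> a < b" "\<not> b < a"
      by (auto simp: order_isomorphic_def All_less_Suc numeral_2_eq_2)
    with ys show "\<exists>a. ys = [a, a]"
      by auto
  next
    assume "\<exists>a. ys = [a, a]"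
    then show "order_isomorphic ys [0, 0 :: nat]"
      by (auto simp: order_isomorphic_def less_Suc_eq)
  qed
  have "(\<exists>a. subseq [a, a] xs) \<longleftrightarrow> \<not> distinct xs"
  proof (induction xs)
    case Nil
    then show ?case by simp
  next
    case (Cons x xs)
    have "b \<in> set xs" if "subseq [b, b] xs" for b
      using that by (meson subseq_Cons' subseq_singleton_left)
    then have "(\<exists>a. subseq [a, a] (x # xs)) \<longleftrightarrow> x \<in> set xs \<or> (\<exists>a. subseq [a, a] xs)"
      by (simp add: subseq_Cons2_iff subseq_singleton_left) metis
    with Cons.IH show ?case by auto
  qed
  then show ?thesis
    by (auto simp: avoids_def iso)
qed

definition num_p_ascent_avoiding :: "nat \<Rightarrow> nat \<Rightarrow> nat list \<Rightarrow> nat" where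
  "num_p_ascent_avoiding n p pat =
     card {xs. length xs = n \<and> p_ascent_sequence p xs \<and> avoids xs pat}"

end

(* If xs is a 2-ascent sequence with distinct letters, length n and d descents, then its letters
   lie in {..2 + asc xs}, so there are 3 + (n - 1 - d) - n = 2 - d possible next letters. Starting
   from 0, 1, 2, ... one may skip a letter c once, may later insert c at some position k, and
   from then on everything is forced. So the sequences other than [0..<n] correspond to the
   pairs 1 \<le> c < k \<le> n, where k = n means that c has not been inserted. *)
theory Submission
  imports Defs
begin

text \<open>For \<open>c < k\<close> this is the cyclic permutation c -> c+1 -> ... -> k -> c of the
  naturals, fixing everything else.\<close>

definition skip_letter :: "nat \<Rightarrow> nat \<Rightarrow> nat \<Rightarrow> nat" where
  "skip_letter c k i = (if i < c then i else if i < k then Suc i else if i = k then c else i)"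

definition skip_word :: "nat \<Rightarrow> nat \<Rightarrow> nat \<Rightarrow> nat list" where
  "skip_word c k n = map (skip_letter c k) [0..<n]"

lemma length_skip_word [simp]: "length (skip_word c k n) = n"
  by (simp add: skip_word_def)

lemma skip_word_Suc: "skip_word c k (Suc n) = skip_word c k n @ [skip_letter c k n]"
  by (simp add: skip_word_def)

text \<open>A prefix of length \<open>n\<close> does not reach an insertion position that is at
  least \<open>n\<close>. An open gap can thus be recorded with either \<open>n\<close> or
  \<open>Suc n\<close> as its second parameter.\<close>

lemma skip_word_cong: "n \<le> k \<Longrightarrow> n \<le> l \<Longrightarrow> skip_word c k n = skip_word c l n"
  by (auto simp: skip_word_def skip_letter_def)

lemma skip_word_eq_upt: "n \<le> c \<Longrightarrow> skip_word c k n = [0..<n]"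
  by (auto simp: skip_word_def skip_letter_def intro: map_idI)

lemma set_skip_word_missing:
  assumes "c \<le> n" "n \<le> k"
  shows "set (skip_word c k n) = {..n} - {c}"
  using assms
proof (induction n rule: dec_induct)
  \<comment> \<open>At length \<open>c\<close> nothing has been skipped yet, and
    \<open>{..c} - {c}\<close> is \<open>{..<c}\<close>.\<close>
  case base
  then show ?case by (auto simp: skip_word_eq_upt)
next
  case (step n)
  have "set (skip_word c k (Suc n)) = insert (Suc n) (set (skip_word c k n))"
    using step.hyps step.prems by (simp add: skip_word_Suc skip_letter_def)
  also have "set (skip_word c k n) = {..n} - {c}"
    using step.IH step.prems by simp
  also have "insert (Suc n) ({..n} - {c}) = {..Suc n} - {c}"
    using step.hyps by auto
  finally show ?case .
qed

lemma set_skip_word_complete: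
  assumes "c < k" "k < n"
  shows "set (skip_word c k n) = {..<n}"
proof -
  \<comment> \<open>\<open>Suc k\<close> is the first length at which \<open>c\<close> has been
    inserted, closing the only gap; each later position adds its own index.\<close>
  from assms(2) have "Suc k \<le> n" by simp
  then show ?thesis
  proof (induction n rule: dec_induct)
    case base
    have "set (skip_word c k (Suc k)) = insert c ({..k} - {c})"
      using assms(1) set_skip_word_missing[of c k k] by (simp add: skip_word_Suc skip_letter_def)
    also have "\<dots> = {..<Suc k}"
      using assms(1) by auto
    finally show ?case .
  next
    case (step n)
    have "set (skip_word c k (Suc n)) = insert n (set (skip_word c k n))"
      using assms(1) step.hyps by (simp add: skip_word_Suc skip_letter_def)
    with step.IH show ?case by (simp add: lessThan_Suc)
  qed
qed

lemma asc_map_upt: "asc (map f [0..<n]) = card {j. Suc j < n \<and> f j < f (Suc j)}"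
proof -
  have "{j. Suc j < length (map f [0..<n]) \<and> map f [0..<n] ! j < map f [0..<n] ! Suc j} =
      {j. Suc j < n \<and> f j < f (Suc j)}"
    by auto
  then show ?thesis by (simp add: asc_def)
qed

lemma asc_upt: "asc [0..<n] = n - 1"
proof -
  have "{j. Suc j < n} = {..<n - 1}" by auto
  then show ?thesis using asc_map_upt[of id n] by simp
qed

lemma asc_skip_word_missing:
  assumes "n \<le> k"
  shows "asc (skip_word c k n) = n - 1"
proof -
  have "{j. Suc j < n \<and> skip_letter c k j < skip_letter c k (Suc j)} = {..<n - 1}"
    using assms by (auto simp: skip_letter_def)
  then show ?thesis by (simp add: skip_word_def asc_map_upt)
qed

text \<open>The only descent leads from the letter \<open>k\<close> at position \<open>k - 1\<close>
  to \<open>c\<close> at position \<open>k\<close>.\<close>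

lemma asc_skip_word_complete:
  assumes "c < k" "k < n"
  shows "asc (skip_word c k n) = n - 2"
proof -
  have "{j. Suc j < n \<and> skip_letter c k j < skip_letter c k (Suc j)} = {..<n - 1} - {k - 1}"
    using assms by (auto simp: skip_letter_def)
  with assms show ?thesis by (simp add: skip_word_def asc_map_upt)
qed

lemma inj_on_skip_word: "inj_on (\<lambda>(c, k). skip_word c k n) {(c, k). c < k \<and> k \<le> n}"
proof -
  \<comment> \<open>At position \<open>c\<close> the first word already has \<open>Suc c\<close>,
    the second still \<open>c\<close>.\<close>
  have first: False if "skip_word c k n = skip_word c' k' n" "c < c'" "c < k" "k \<le> n" for c k c' k'
  proof -
    from that have "skip_word c k n ! c = skip_word c' k' n ! c" by simp
    with that show False by (auto simp: skip_word_def skip_letter_def)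
  qed
  \<comment> \<open>At position \<open>k\<close> the first word has \<open>c\<close>, the second
    \<open>Suc k\<close>.\<close>
  have second: False if "skip_word c k n = skip_word c k' n" "c < k" "k < k'" "k' \<le> n" for c k k'
  proof -
    from that have "skip_word c k n ! k = skip_word c k' n ! k" by simp
    with that show False by (auto simp: skip_word_def skip_letter_def)
  qed
  have "c = c' \<and> k = k'"
    if "skip_word c k n = skip_word c' k' n" "c < k" "k \<le> n" "c' < k'" "k' \<le> n" for c k c' k'
  proof -
    have "c = c'" using first that by (metis nat_neq_iff)
    moreover then have "k = k'" using second that by (metis nat_neq_iff)
    ultimately show ?thesis by blast
  qed
  then show ?thesis by (auto simp: inj_on_def)
qed

lemma skip_word_neq_upt:
  assumes "c < k" "k \<le> n"
  shows "skip_word c k n \<noteq> [0..<n]"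
proof
  assume "skip_word c k n = [0..<n]"
  then have "skip_word c k n ! c = [0..<n] ! c" by simp
  with assms show False by (auto simp: skip_word_def skip_letter_def)
qed

text \<open>Each bound depends only on the preceding prefix, so a new last letter adds a single
  condition.\<close>

lemma p_ascent_sequence_snoc:
  assumes "xs \<noteq> []"
  shows "p_ascent_sequence p (xs @ [x]) \<longleftrightarrow> p_ascent_sequence p xs \<and> x \<le> p + asc xs"
proof -
  have *: "Suc 0 \<le> length xs" using assms by (simp add: Suc_le_eq)
  have "(\<forall>i. 1 \<le> i \<and> i < length (xs @ [x]) \<longrightarrow> (xs @ [x]) ! i \<le> p + asc (take i (xs @ [x]))) \<longleftrightarrow>
      (\<forall>i. 1 \<le> i \<and> i < length xs \<longrightarrow> xs ! i \<le> p + asc (take i xs)) \<and> x \<le> p + asc xs"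
    using * by (auto simp: nth_append less_Suc_eq)
  with assms show ?thesis by (simp add: p_ascent_sequence_def nth_append)
qed

text \<open>Induction on the length by removing the last letter. The bound \<open>1 \<le> c\<close>
  is there because the first letter must be 0.\<close>

lemma distinct_2_ascent_sequence_iff:
  assumes "length xs = n" "n \<ge> 1"
  shows "p_ascent_sequence 2 xs \<and> distinct xs \<longleftrightarrow>
    xs = [0..<n] \<or> (\<exists>c k. 1 \<le> c \<and> c < k \<and> k \<le> n \<and> xs = skip_word c k n)"
  using assms(2,1)
proof (induction n arbitrary: xs rule: dec_induct)
  case base
  then obtain a where "xs = [a]" by (auto simp: length_Suc_conv)
  then show ?case by (auto simp: p_ascent_sequence_def)
next
  case (step n)
  then obtain ys x where xs: "xs = ys @ [x]" and len: "length ys = n"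
    by (auto simp: length_Suc_conv_rev)
  have "ys \<noteq> []" using len step.hyps by auto
  then have snoc: "p_ascent_sequence 2 xs \<and> distinct xs \<longleftrightarrow>
      (p_ascent_sequence 2 ys \<and> distinct ys) \<and> x \<le> 2 + asc ys \<and> x \<notin> set ys"
    by (auto simp: xs p_ascent_sequence_snoc)
  note IH = step.IH[OF len]
  show ?case
  proof
    assume "p_ascent_sequence 2 xs \<and> distinct xs"
    with snoc IH have x: "x \<le> 2 + asc ys" "x \<notin> set ys"
      and ys: "ys = [0..<n] \<or> (\<exists>c k. 1 \<le> c \<and> c < k \<and> k \<le> n \<and> ys = skip_word c k n)"
      by auto
    \<comment> \<open>For \<open>k = n\<close> the letter \<open>c\<close> is still missing; for
      \<open>k < n\<close> it has been inserted. The admissible letters differ accordingly.\<close>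
    from ys consider (upt) "ys = [0..<n]"
      | (missing) c where "1 \<le> c" "c < n" "ys = skip_word c n n"
      | (complete) c k where "1 \<le> c" "c < k" "k < n" "ys = skip_word c k n"
      by (metis le_neq_implies_less)
    then show "xs = [0..<Suc n] \<or>
        (\<exists>c k. 1 \<le> c \<and> c < k \<and> k \<le> Suc n \<and> xs = skip_word c k (Suc n))"
    proof cases
      case upt
      \<comment> \<open>The bound \<open>2 + (n - 1)\<close> is \<open>Suc n\<close>, and the used
        letters are those below \<open>n\<close>.\<close>
      with x step.hyps have "x = n \<or> x = Suc n" by (auto simp: asc_upt)
      \<comment> \<open>Choosing \<open>Suc n\<close> skips the letter \<open>n\<close> and opens a
        gap.\<close>
      moreover have "skip_word n (Suc n) (Suc n) = [0..<n] @ [Suc n]"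
        by (simp add: skip_word_Suc skip_word_eq_upt skip_letter_def)
      ultimately show ?thesis using upt xs step.hyps
        by (metis lessI order_refl upt_Suc_append zero_le)
    next
      case missing
      \<comment> \<open>The bound is again \<open>Suc n\<close>, with \<open>{..n} - {c}\<close>
        used: the gap is filled at position \<open>n\<close> or stays open.\<close>
      then have "x = c \<or> x = Suc n"
        using x by (auto simp: asc_skip_word_missing set_skip_word_missing)
      moreover have "skip_word c n (Suc n) = ys @ [c]"
        using missing by (simp add: skip_word_Suc skip_letter_def)
      moreover have "skip_word c (Suc n) (Suc n) = ys @ [Suc n]"
        using missing skip_word_cong[of n n "Suc n" c]
        by (simp add: skip_word_Suc skip_letter_def)
      ultimately show ?thesis using missing xs
        by (metis less_Suc_eq order_refl le_Suc_eq)
    next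
      case complete
      \<comment> \<open>The descent lowers the bound to \<open>2 + (n - 2)\<close>, which is
        \<open>n\<close>, and all smaller letters are used.\<close>
      then have "x = n"
        using x by (auto simp: asc_skip_word_complete set_skip_word_complete)
      with complete have "xs = skip_word c k (Suc n)"
        by (simp add: xs skip_word_Suc skip_letter_def)
      with complete show ?thesis by (metis le_SucI less_imp_le)
    qed
  next
    assume "xs = [0..<Suc n] \<or>
        (\<exists>c k. 1 \<le> c \<and> c < k \<and> k \<le> Suc n \<and> xs = skip_word c k (Suc n))"
    then consider (upt) "xs = [0..<Suc n]"
      | (word) c k where "1 \<le> c" "c < k" "k \<le> Suc n" "xs = skip_word c k (Suc n)"
      by blast
    then show "p_ascent_sequence 2 xs \<and> distinct xs"
    proof cases
      case upt
      then have "ys = [0..<n]" "x = n" using xs by auto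
      then show ?thesis using snoc IH step.hyps by (auto simp: asc_upt)
    next
      case word
      then have ys: "ys = skip_word c k n" and x: "x = skip_letter c k n"
        using xs by (auto simp: skip_word_Suc)
      \<comment> \<open>The last position opens the gap, keeps it open, fills it with
        \<open>c\<close>, or comes after the insertion.\<close>
      consider "c = n" "k = Suc n" | "c < n" "k = Suc n" | "k = n" | "k < n"
        using word by linarith
      then show ?thesis
      proof cases
        case 1
        then have "ys = [0..<n]" "x = Suc n"
          using ys x by (auto simp: skip_word_eq_upt skip_letter_def)
        then show ?thesis using snoc IH step.hyps by (auto simp: asc_upt)
      next
        case 2
        then have "ys = skip_word c n n" "x = Suc n"
          using ys x skip_word_cong[of n n "Suc n" c] by (auto simp: skip_letter_def)
        with 2 word(1) show ?thesis unfolding snoc IH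
          by (auto simp: asc_skip_word_missing set_skip_word_missing)
      next
        case 3
        with word ys x show ?thesis unfolding snoc IH
          by (auto simp: asc_skip_word_missing set_skip_word_missing skip_letter_def)
      next
        case 4
        with word(1,2) have "ys = [0..<n] \<or>
            (\<exists>c k. 1 \<le> c \<and> c < k \<and> k \<le> n \<and> ys = skip_word c k n)"
          using ys less_imp_le by blast
        with 4 word(1,2) ys x show ?thesis unfolding snoc IH
          by (simp add: asc_skip_word_complete set_skip_word_complete skip_letter_def)
      qed
    qed
  qed
qed

lemma card_ordered_pairs: "card {(c, k). 1 \<le> c \<and> c < k \<and> k \<le> (n::nat)} = n choose 2"
proof -
  \<comment> \<open>Grouping by \<open>k\<close> leaves \<open>k - 1\<close> choices of
    \<open>c\<close>; truncated subtraction gives the correct value 0 at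
    \<open>k = 0\<close>.\<close>
  have "{(c, k). 1 \<le> c \<and> c < k \<and> k \<le> n} = prod.swap ` (SIGMA k:{..n}. {1..<k})"
    by (auto simp: image_iff)
  then have "card {(c, k). 1 \<le> c \<and> c < k \<and> k \<le> n} = (\<Sum>k\<le>n. k - 1)"
    by (simp add: card_image)
  \<comment> \<open>The summand added at \<open>Suc n\<close> is \<open>n\<close>, as in Pascal's
    rule.\<close>
  also have "\<dots> = n choose 2"
    by (induction n) (auto simp: numeral_2_eq_2)
  finally show ?thesis .
qed

theorem theorem4p1:
  fixes n :: nat
  assumes "n \<ge> 1"
  shows "num_p_ascent_avoiding n 2 [0, 0] = 1 + (n choose 2)"
proof -
  let ?P = "{(c, k). 1 \<le> c \<and> c < k \<and> k \<le> n}"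
  let ?W = "(\<lambda>(c, k). skip_word c k n) ` ?P"
  have "?P \<subseteq> {..n} \<times> {..n}" by auto
  then have fin: "finite ?P" by (rule finite_subset) simp
  have "{xs. length xs = n \<and> p_ascent_sequence 2 xs \<and> avoids xs [0, 0]} = insert [0..<n] ?W"
  proof (rule set_eqI)
    fix xs
    have W: "xs \<in> ?W \<longleftrightarrow> (\<exists>c k. 1 \<le> c \<and> c < k \<and> k \<le> n \<and> xs = skip_word c k n)"
      by auto
    show "xs \<in> {xs. length xs = n \<and> p_ascent_sequence 2 xs \<and> avoids xs [0, 0]} \<longleftrightarrow>
        xs \<in> insert [0..<n] ?W"
    \<comment> \<open>Both sides contain only words of length \<open>n\<close>, so other lengths are
      trivial.\<close>
    proof (cases "length xs = n")
      case True
      then show ?thesis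
        unfolding insert_iff W distinct_2_ascent_sequence_iff[OF True assms, symmetric]
        by (simp add: avoids_00_iff_distinct)
    qed auto
  qed
  \<comment> \<open>This makes the increasing word contribute the separate summand 1.\<close>
  moreover have "[0..<n] \<notin> ?W"
    using skip_word_neq_upt by (force dest: sym)
  moreover have "card ?W = n choose 2"
  proof -
    have "inj_on (\<lambda>(c, k). skip_word c k n) ?P"
      by (rule inj_on_subset[OF inj_on_skip_word]) auto
    then show ?thesis by (simp only: card_image card_ordered_pairs)
  qed
  ultimately show ?thesis
    using fin by (simp add: num_p_ascent_avoiding_def)
qed

end
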